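(* Let $(!,\delta,\varepsilon,\Delta,e,\nabla,u)$ be an additive bialgebra modality on an additive symmetric monoidal category. Every deriving transformation $\mathsf{d}:{!A}\otimes A\to{!A}$ satisfies the $\nabla$-rule $(\nabla\otimes1)\mathsf{d}=(1\otimes\mathsf{d})\nabla$, and thus is induced equivalently by a codereliction; that is, $\mathsf{d}\mapsto\eta:=(u\otimes1)\mathsf{d}$ and $\eta\mapsto\mathsf{d}:=(1\otimes\eta)\nabla$ are mutually inverse bijections between deriving transformations and coderelictions.
   Context: Composition is in diagrammatic order ($fg$ means first $f$, then $g$). Symmetric monoidal categories are treated as strict (associators and unitors suppressed), with tensor $\otimes$, unit $K$, symmetry $\sigma:A\otimes B\to B\otimes A$. An additive symmetric monoidal category is a symmetric monoidal category enriched in commutative monoids (hom-sets have $+$ and $0$, no negatives, no biproducts assumed), with composition and $\otimes$ preserving $+$ and $0$ in each variable. A coalgebra modality $(!,\delta,\varepsilon,\Delta,e)$ is a comonad $(!,\delta,\varepsilon)$, $\delta:{!A}\to{!!A}$, $\varepsilon:{!A}\to A$, with natural transformations $\Delta:{!A}\to{!A}\otimes{!A}$, $e:{!A}\to K$ such that each $({!A},\Delta,e)$ is a cocommutative comonoid and $\delta\Delta=\Delta(\delta\otimes\delta)$. A bialgebra modality $(!,\delta,\varepsilon,\Delta,e,\nabla,u)$ is a coalgebra modality with natural transformations $\nabla:{!A}\otimes{!A}\to{!A}$, $u:K\to{!A}$ such that $({!A},\nabla,u)$ is a commutative monoid, $\nabla e=e\otimes e$, $u\Delta=u\otimes u$,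 $ue=1$, $\nabla\Delta=(\Delta\otimes\Delta)(1\otimes\sigma\otimes1)(\nabla\otimes\nabla)$, and $\nabla\varepsilon=\varepsilon\otimes e+e\otimes\varepsilon$. It is additive if for all parallel maps $f,g$: $!(f+g)=\Delta(!(f)\otimes!(g))\nabla$ and $!(0)=eu$. A deriving transformation for a coalgebra modality is a natural transformation $\mathsf{d}:{!A}\otimes A\to{!A}$ satisfying: constant rule $\mathsf{d}e=0$; product rule $\mathsf{d}\Delta=(\Delta\otimes1)((1\otimes\mathsf{d})+(1\otimes\sigma)(\mathsf{d}\otimes1))$; linear rule $\mathsf{d}\varepsilon=e\otimes1$; chain rule $\mathsf{d}\delta=(\Delta\otimes1)(\delta\otimes\mathsf{d})\mathsf{d}$ (the last $\mathsf{d}$ is at ${!A}$); interchange rule $(\mathsf{d}\otimes1)\mathsf{d}=(1\otimes\sigma)(\mathsf{d}\otimes1)\mathsf{d}$. A codereliction for a bialgebra modality is a natural transformation $\eta:A\to{!A}$ satisfying: $\eta e=0$; $\eta\Delta=\eta\otimes u+u\otimes\eta$; $\eta\varepsilon=1$; and the chain rule $(1\otimes\eta)\nabla\delta=(\Delta\otimes\eta)(1\otimes\nabla)(\delta\otimes\eta)\nabla$ as maps ${!A}\otimes A\to{!!A}$ (the second $\eta$ on the right-hand side is at ${!A}$). *)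

theory Defs
  imports "HOL-Library.FuncSet"
begin

text \<open>
  Categories are given by carriers of objects and arrows. Composition \<open>f \<cdot> g\<close> is in diagrammatic
  order (first \<open>f\<close>, then \<open>g\<close>), and the monoidal structure is strict. The values of all operations
  are constrained only on the carriers and on composable or parallel arrows.
  \<open>\<odot>\<close> is the tensor on objects and \<open>\<otimes>\<close> the tensor on arrows; \<open>\<otimes>\<close> binds more tightly than
  \<open>\<cdot>\<close>, and \<open>\<cdot>\<close> more tightly than \<open>\<oplus>\<close>.
\<close>

record ('o, 'a) additive_smc_data =
  Obj :: "'o set"
  Arr :: "'a set"
  Dom :: "'a \<Rightarrow> 'o"
  Cod :: "'a \<Rightarrow> 'o"
  Id :: "'o \<Rightarrow> 'a" ("\<one>\<index>")
  Comp :: "'a \<Rightarrow> 'a \<Rightarrow> 'a" (infixl "\<cdot>\<index>" 70)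
  TensorO :: "'o \<Rightarrow> 'o \<Rightarrow> 'o" (infixl "\<odot>\<index>" 75)
  TensorA :: "'a \<Rightarrow> 'a \<Rightarrow> 'a" (infixl "\<otimes>\<index>" 75)
  Unit :: "'o" ("\<K>\<index>")
  Sym :: "'o \<Rightarrow> 'o \<Rightarrow> 'a" ("\<sigma>\<index>")
  Plus :: "'a \<Rightarrow> 'a \<Rightarrow> 'a" (infixl "\<oplus>\<index>" 65)
  Zero :: "'o \<Rightarrow> 'o \<Rightarrow> 'a" ("\<zero>\<index>")

definition Hom :: "('o, 'a, 'x) additive_smc_data_scheme \<Rightarrow> 'o \<Rightarrow> 'o \<Rightarrow> 'a set" where
  "Hom C A B = {f \<in> Arr C. Dom C f = A \<and> Cod C f = B}"

locale category =
  fixes C :: "('o, 'a, 'x) additive_smc_data_scheme" (structure)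
  assumes Dom_Obj: "f \<in> Arr C \<Longrightarrow> Dom C f \<in> Obj C"
    and Cod_Obj: "f \<in> Arr C \<Longrightarrow> Cod C f \<in> Obj C"
    and Id_Hom: "A \<in> Obj C \<Longrightarrow> \<one> A \<in> Hom C A A"
    and Comp_Hom: "\<lbrakk>f \<in> Hom C A B; g \<in> Hom C B D\<rbrakk> \<Longrightarrow> f \<cdot> g \<in> Hom C A D"
    and Id_Comp: "f \<in> Hom C A B \<Longrightarrow> \<one> A \<cdot> f = f"
    and Comp_Id: "f \<in> Hom C A B \<Longrightarrow> f \<cdot> \<one> B = f"
    and Comp_assoc: "\<lbrakk>f \<in> Hom C A B; g \<in> Hom C B D; h \<in> Hom C D E\<rbrakk>
      \<Longrightarrow> (f \<cdot> g) \<cdot> h = f \<cdot> (g \<cdot> h)"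

locale strict_monoidal_category = category +
  assumes Unit_Obj: "\<K> \<in> Obj C"
    and TensorO_Obj: "\<lbrakk>A \<in> Obj C; B \<in> Obj C\<rbrakk> \<Longrightarrow> A \<odot> B \<in> Obj C"
    and TensorA_Hom: "\<lbrakk>f \<in> Hom C A A'; g \<in> Hom C B B'\<rbrakk> \<Longrightarrow> f \<otimes> g \<in> Hom C (A \<odot> B) (A' \<odot> B')"
    and TensorA_Id: "\<lbrakk>A \<in> Obj C; B \<in> Obj C\<rbrakk> \<Longrightarrow> \<one> A \<otimes> \<one> B = \<one> (A \<odot> B)"
    and TensorA_Comp: "\<lbrakk>f \<in> Hom C A A'; f' \<in> Hom C A' A''; g \<in> Hom C B B'; g' \<in> Hom C B' B''\<rbrakk>
      \<Longrightarrow> (f \<cdot> f') \<otimes> (g \<cdot> g') = (f \<otimes> g) \<cdot> (f' \<otimes> g')"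
    and TensorO_assoc: "\<lbrakk>A \<in> Obj C; B \<in> Obj C; D \<in> Obj C\<rbrakk> \<Longrightarrow> (A \<odot> B) \<odot> D = A \<odot> (B \<odot> D)"
    and TensorA_assoc: "\<lbrakk>f \<in> Arr C; g \<in> Arr C; h \<in> Arr C\<rbrakk> \<Longrightarrow> (f \<otimes> g) \<otimes> h = f \<otimes> (g \<otimes> h)"
    and Unit_TensorO: "A \<in> Obj C \<Longrightarrow> \<K> \<odot> A = A"
    and TensorO_Unit: "A \<in> Obj C \<Longrightarrow> A \<odot> \<K> = A"
    and Unit_TensorA: "f \<in> Arr C \<Longrightarrow> \<one> \<K> \<otimes> f = f"
    and TensorA_Unit: "f \<in> Arr C \<Longrightarrow> f \<otimes> \<one> \<K> = f"

text \<open>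
  The remaining unit law \<open>\<sigma> A \<K> = \<one> A\<close> follows from the hexagon law and invertibility of \<open>\<sigma>\<close>.
\<close>

locale strict_symmetric_monoidal_category = strict_monoidal_category +
  assumes Sym_Hom: "\<lbrakk>A \<in> Obj C; B \<in> Obj C\<rbrakk> \<Longrightarrow> \<sigma> A B \<in> Hom C (A \<odot> B) (B \<odot> A)"
    and Sym_natural: "\<lbrakk>f \<in> Hom C A A'; g \<in> Hom C B B'\<rbrakk>
      \<Longrightarrow> (f \<otimes> g) \<cdot> \<sigma> A' B' = \<sigma> A B \<cdot> (g \<otimes> f)"
    and Sym_involutive: "\<lbrakk>A \<in> Obj C; B \<in> Obj C\<rbrakk> \<Longrightarrow> \<sigma> A B \<cdot> \<sigma> B A = \<one> (A \<odot> B)"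
    and Sym_hexagon: "\<lbrakk>A \<in> Obj C; B \<in> Obj C; D \<in> Obj C\<rbrakk>
      \<Longrightarrow> \<sigma> A (B \<odot> D) = (\<sigma> A B \<otimes> \<one> D) \<cdot> (\<one> B \<otimes> \<sigma> A D)"

locale additive_symmetric_monoidal_category = strict_symmetric_monoidal_category +
  assumes Zero_Hom: "\<lbrakk>A \<in> Obj C; B \<in> Obj C\<rbrakk> \<Longrightarrow> \<zero> A B \<in> Hom C A B"
    and Plus_Hom: "\<lbrakk>f \<in> Hom C A B; g \<in> Hom C A B\<rbrakk> \<Longrightarrow> f \<oplus> g \<in> Hom C A B"
    and Plus_assoc: "\<lbrakk>f \<in> Hom C A B; g \<in> Hom C A B; h \<in> Hom C A B\<rbrakk>
      \<Longrightarrow> (f \<oplus> g) \<oplus> h = f \<oplus> (g \<oplus> h)"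
    and Plus_commute: "\<lbrakk>f \<in> Hom C A B; g \<in> Hom C A B\<rbrakk> \<Longrightarrow> f \<oplus> g = g \<oplus> f"
    and Zero_Plus: "f \<in> Hom C A B \<Longrightarrow> \<zero> A B \<oplus> f = f"
    and Comp_Plus: "\<lbrakk>f \<in> Hom C A B; g \<in> Hom C B D; h \<in> Hom C B D\<rbrakk>
      \<Longrightarrow> f \<cdot> (g \<oplus> h) = (f \<cdot> g) \<oplus> (f \<cdot> h)"
    and Plus_Comp: "\<lbrakk>f \<in> Hom C A B; g \<in> Hom C A B; h \<in> Hom C B D\<rbrakk>
      \<Longrightarrow> (f \<oplus> g) \<cdot> h = (f \<cdot> h) \<oplus> (g \<cdot> h)"
    and Comp_Zero: "\<lbrakk>f \<in> Hom C A B; D \<in> Obj C\<rbrakk> \<Longrightarrow> f \<cdot> \<zero> B D = \<zero> A D"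
    and Zero_Comp: "\<lbrakk>A \<in> Obj C; f \<in> Hom C B D\<rbrakk> \<Longrightarrow> \<zero> A B \<cdot> f = \<zero> A D"
    and TensorA_Plus: "\<lbrakk>f \<in> Hom C A A'; g \<in> Hom C B B'; h \<in> Hom C B B'\<rbrakk>
      \<Longrightarrow> f \<otimes> (g \<oplus> h) = (f \<otimes> g) \<oplus> (f \<otimes> h)"
    and Plus_TensorA: "\<lbrakk>f \<in> Hom C A A'; g \<in> Hom C A A'; h \<in> Hom C B B'\<rbrakk>
      \<Longrightarrow> (f \<oplus> g) \<otimes> h = (f \<otimes> h) \<oplus> (g \<otimes> h)"
    and TensorA_Zero: "\<lbrakk>f \<in> Hom C A A'; B \<in> Obj C; B' \<in> Obj C\<rbrakk>
      \<Longrightarrow> f \<otimes> \<zero> B B' = \<zero> (A \<odot> B) (A' \<odot> B')"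
    and Zero_TensorA: "\<lbrakk>A \<in> Obj C; A' \<in> Obj C; g \<in> Hom C B B'\<rbrakk>
      \<Longrightarrow> \<zero> A A' \<otimes> g = \<zero> (A \<odot> B) (A' \<odot> B')"

text \<open>
  The functor underlying the comonad is \<open>bangO\<close> on objects and \<open>bangA\<close> on arrows. It is not
  required to preserve the additive structure. Natural transformations are families of arrows
  indexed by objects.
\<close>

locale endofunctor = category C
  for C :: "('o, 'a, 'x) additive_smc_data_scheme" (structure) +
  fixes bangO :: "'o \<Rightarrow> 'o" and bangA :: "'a \<Rightarrow> 'a"
  assumes bangO_Obj: "A \<in> Obj C \<Longrightarrow> bangO A \<in> Obj C"
    and bangA_Hom: "f \<in> Hom C A B \<Longrightarrow> bangA f \<in> Hom C (bangO A) (bangO B)"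
    and bangA_Id: "A \<in> Obj C \<Longrightarrow> bangA (\<one> A) = \<one> (bangO A)"
    and bangA_Comp: "\<lbrakk>f \<in> Hom C A B; g \<in> Hom C B D\<rbrakk> \<Longrightarrow> bangA (f \<cdot> g) = bangA f \<cdot> bangA g"

locale comonad = endofunctor C bangO bangA
  for C :: "('o, 'a, 'x) additive_smc_data_scheme" (structure) and bangO bangA +
  fixes \<delta> \<epsilon> :: "'o \<Rightarrow> 'a"
  assumes \<delta>_Hom: "A \<in> Obj C \<Longrightarrow> \<delta> A \<in> Hom C (bangO A) (bangO (bangO A))"
    and \<delta>_natural: "f \<in> Hom C A B \<Longrightarrow> bangA f \<cdot> \<delta> B = \<delta> A \<cdot> bangA (bangA f)"
    and \<epsilon>_Hom: "A \<in> Obj C \<Longrightarrow> \<epsilon> A \<in> Hom C (bangO A) A"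
    and \<epsilon>_natural: "f \<in> Hom C A B \<Longrightarrow> bangA f \<cdot> \<epsilon> B = \<epsilon> A \<cdot> f"
    and \<delta>_\<epsilon>: "A \<in> Obj C \<Longrightarrow> \<delta> A \<cdot> \<epsilon> (bangO A) = \<one> (bangO A)"
    and \<delta>_bang_\<epsilon>: "A \<in> Obj C \<Longrightarrow> \<delta> A \<cdot> bangA (\<epsilon> A) = \<one> (bangO A)"
    and \<delta>_\<delta>: "A \<in> Obj C \<Longrightarrow> \<delta> A \<cdot> \<delta> (bangO A) = \<delta> A \<cdot> bangA (\<delta> A)"

locale coalgebra_modality =
  strict_symmetric_monoidal_category C + comonad C bangO bangA \<delta> \<epsilon>
  for C :: "('o, 'a, 'x) additive_smc_data_scheme" (structure) and bangO bangA \<delta> \<epsilon> +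
  fixes \<Delta> e :: "'o \<Rightarrow> 'a"
  assumes \<Delta>_Hom: "A \<in> Obj C \<Longrightarrow> \<Delta> A \<in> Hom C (bangO A) (bangO A \<odot> bangO A)"
    and \<Delta>_natural: "f \<in> Hom C A B \<Longrightarrow> bangA f \<cdot> \<Delta> B = \<Delta> A \<cdot> (bangA f \<otimes> bangA f)"
    and e_Hom: "A \<in> Obj C \<Longrightarrow> e A \<in> Hom C (bangO A) \<K>"
    and e_natural: "f \<in> Hom C A B \<Longrightarrow> bangA f \<cdot> e B = e A"
    and \<Delta>_coassoc: "A \<in> Obj C \<Longrightarrow> \<Delta> A \<cdot> (\<Delta> A \<otimes> \<one> (bangO A)) = \<Delta> A \<cdot> (\<one> (bangO A) \<otimes> \<Delta> A)"
    and \<Delta>_counit_left: "A \<in> Obj C \<Longrightarrow> \<Delta> A \<cdot> (e A \<otimes> \<one> (bangO A)) = \<one> (bangO A)"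
    and \<Delta>_counit_right: "A \<in> Obj C \<Longrightarrow> \<Delta> A \<cdot> (\<one> (bangO A) \<otimes> e A) = \<one> (bangO A)"
    and \<Delta>_cocommutative: "A \<in> Obj C \<Longrightarrow> \<Delta> A \<cdot> \<sigma> (bangO A) (bangO A) = \<Delta> A"
    and \<delta>_\<Delta>: "A \<in> Obj C \<Longrightarrow> \<delta> A \<cdot> \<Delta> (bangO A) = \<Delta> A \<cdot> (\<delta> A \<otimes> \<delta> A)"

locale bialgebra_modality =
  additive_symmetric_monoidal_category C + coalgebra_modality C bangO bangA \<delta> \<epsilon> \<Delta> e
  for C :: "('o, 'a, 'x) additive_smc_data_scheme" (structure) and bangO bangA \<delta> \<epsilon> \<Delta> e +
  fixes nabla u :: "'o \<Rightarrow> 'a"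
  assumes nabla_Hom: "A \<in> Obj C \<Longrightarrow> nabla A \<in> Hom C (bangO A \<odot> bangO A) (bangO A)"
    and nabla_natural: "f \<in> Hom C A B \<Longrightarrow> (bangA f \<otimes> bangA f) \<cdot> nabla B = nabla A \<cdot> bangA f"
    and u_Hom: "A \<in> Obj C \<Longrightarrow> u A \<in> Hom C \<K> (bangO A)"
    and u_natural: "f \<in> Hom C A B \<Longrightarrow> u A \<cdot> bangA f = u B"
    and nabla_assoc: "A \<in> Obj C
      \<Longrightarrow> (nabla A \<otimes> \<one> (bangO A)) \<cdot> nabla A = (\<one> (bangO A) \<otimes> nabla A) \<cdot> nabla A"
    and nabla_unit_left: "A \<in> Obj C \<Longrightarrow> (u A \<otimes> \<one> (bangO A)) \<cdot> nabla A = \<one> (bangO A)"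
    and nabla_unit_right: "A \<in> Obj C \<Longrightarrow> (\<one> (bangO A) \<otimes> u A) \<cdot> nabla A = \<one> (bangO A)"
    and nabla_commutative: "A \<in> Obj C \<Longrightarrow> \<sigma> (bangO A) (bangO A) \<cdot> nabla A = nabla A"
    and nabla_e: "A \<in> Obj C \<Longrightarrow> nabla A \<cdot> e A = e A \<otimes> e A"
    and u_\<Delta>: "A \<in> Obj C \<Longrightarrow> u A \<cdot> \<Delta> A = u A \<otimes> u A"
    and u_e: "A \<in> Obj C \<Longrightarrow> u A \<cdot> e A = \<one> \<K>"
    and nabla_\<Delta>: "A \<in> Obj C \<Longrightarrow> nabla A \<cdot> \<Delta> A =
      (\<Delta> A \<otimes> \<Delta> A) \<cdot> (\<one> (bangO A) \<otimes> \<sigma> (bangO A) (bangO A) \<otimes> \<one> (bangO A)) \<cdot> (nabla A \<otimes> nabla A)"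
    and nabla_\<epsilon>: "A \<in> Obj C \<Longrightarrow> nabla A \<cdot> \<epsilon> A = \<epsilon> A \<otimes> e A \<oplus> e A \<otimes> \<epsilon> A"

locale additive_bialgebra_modality = bialgebra_modality C bangO bangA \<delta> \<epsilon> \<Delta> e nabla u
  for C :: "('o, 'a, 'x) additive_smc_data_scheme" (structure)
    and bangO bangA \<delta> \<epsilon> \<Delta> e nabla u +
  assumes bangA_Plus: "\<lbrakk>f \<in> Hom C A B; g \<in> Hom C A B\<rbrakk>
      \<Longrightarrow> bangA (f \<oplus> g) = \<Delta> A \<cdot> (bangA f \<otimes> bangA g) \<cdot> nabla B"
    and bangA_Zero: "\<lbrakk>A \<in> Obj C; B \<in> Obj C\<rbrakk> \<Longrightarrow> bangA (\<zero> A B) = e A \<cdot> u B"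

locale deriving_transformation =
  additive_symmetric_monoidal_category C + coalgebra_modality C bangO bangA \<delta> \<epsilon> \<Delta> e
  for C :: "('o, 'a, 'x) additive_smc_data_scheme" (structure) and bangO bangA \<delta> \<epsilon> \<Delta> e +
  fixes d :: "'o \<Rightarrow> 'a"
  assumes d_Hom: "A \<in> Obj C \<Longrightarrow> d A \<in> Hom C (bangO A \<odot> A) (bangO A)"
    and d_natural: "f \<in> Hom C A B \<Longrightarrow> (bangA f \<otimes> f) \<cdot> d B = d A \<cdot> bangA f"
    and constant_rule: "A \<in> Obj C \<Longrightarrow> d A \<cdot> e A = \<zero> (bangO A \<odot> A) \<K>"
    and product_rule: "A \<in> Obj C \<Longrightarrow> d A \<cdot> \<Delta> A =
      (\<Delta> A \<otimes> \<one> A) \<cdot> (\<one> (bangO A) \<otimes> d A \<oplus> (\<one> (bangO A) \<otimes> \<sigma> (bangO A) A) \<cdot> (d A \<otimes> \<one> (bangO A)))"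
    and linear_rule: "A \<in> Obj C \<Longrightarrow> d A \<cdot> \<epsilon> A = e A \<otimes> \<one> A"
    and chain_rule: "A \<in> Obj C \<Longrightarrow> d A \<cdot> \<delta> A = (\<Delta> A \<otimes> \<one> A) \<cdot> (\<delta> A \<otimes> d A) \<cdot> d (bangO A)"
    and interchange_rule: "A \<in> Obj C
      \<Longrightarrow> (d A \<otimes> \<one> A) \<cdot> d A = (\<one> (bangO A) \<otimes> \<sigma> A A) \<cdot> (d A \<otimes> \<one> A) \<cdot> d A"

locale codereliction = bialgebra_modality C bangO bangA \<delta> \<epsilon> \<Delta> e nabla u
  for C :: "('o, 'a, 'x) additive_smc_data_scheme" (structure)
    and bangO bangA \<delta> \<epsilon> \<Delta> e nabla u +
  fixes \<eta> :: "'o \<Rightarrow> 'a"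
  assumes \<eta>_Hom: "A \<in> Obj C \<Longrightarrow> \<eta> A \<in> Hom C A (bangO A)"
    and \<eta>_natural: "f \<in> Hom C A B \<Longrightarrow> f \<cdot> \<eta> B = \<eta> A \<cdot> bangA f"
    and \<eta>_e: "A \<in> Obj C \<Longrightarrow> \<eta> A \<cdot> e A = \<zero> A \<K>"
    and \<eta>_\<Delta>: "A \<in> Obj C \<Longrightarrow> \<eta> A \<cdot> \<Delta> A = \<eta> A \<otimes> u A \<oplus> u A \<otimes> \<eta> A"
    and \<eta>_\<epsilon>: "A \<in> Obj C \<Longrightarrow> \<eta> A \<cdot> \<epsilon> A = \<one> A"
    and \<eta>_chain_rule: "A \<in> Obj C \<Longrightarrow> (\<one> (bangO A) \<otimes> \<eta> A) \<cdot> nabla A \<cdot> \<delta> A =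
      (\<Delta> A \<otimes> \<eta> A) \<cdot> (\<one> (bangO A) \<otimes> nabla A) \<cdot> (\<delta> A \<otimes> \<eta> (bangO A)) \<cdot> nabla (bangO A)"

text \<open>
  A natural transformation is determined by its components at the objects in \<open>Obj C\<close>. Families
  are therefore taken to be \<open>extensional\<close>, so that equality of families is equality of natural
  transformations.
\<close>

definition deriving_transformations where
  "deriving_transformations C bangO bangA \<delta> \<epsilon> \<Delta> e =
    {d \<in> extensional (Obj C). deriving_transformation C bangO bangA \<delta> \<epsilon> \<Delta> e d}"

definition coderelictions where
  "coderelictions C bangO bangA \<delta> \<epsilon> \<Delta> e nabla u =
    {\<eta> \<in> extensional (Obj C). codereliction C bangO bangA \<delta> \<epsilon> \<Delta> e nabla u \<eta>}"

definition codereliction_of ::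
  "('o, 'a, 'x) additive_smc_data_scheme \<Rightarrow> ('o \<Rightarrow> 'a) \<Rightarrow> ('o \<Rightarrow> 'a) \<Rightarrow> 'o \<Rightarrow> 'a" where
  "codereliction_of C u d = (\<lambda>A\<in>Obj C. (u A \<otimes>\<^bsub>C\<^esub> \<one>\<^bsub>C\<^esub> A) \<cdot>\<^bsub>C\<^esub> d A)"

definition deriving_transformation_of ::
  "('o, 'a, 'x) additive_smc_data_scheme \<Rightarrow> ('o \<Rightarrow> 'o) \<Rightarrow> ('o \<Rightarrow> 'a) \<Rightarrow> ('o \<Rightarrow> 'a) \<Rightarrow> 'o \<Rightarrow> 'a" where
  "deriving_transformation_of C bangO nabla \<eta> =
    (\<lambda>A\<in>Obj C. (\<one>\<^bsub>C\<^esub> (bangO A) \<otimes>\<^bsub>C\<^esub> \<eta> A) \<cdot>\<^bsub>C\<^esub> nabla A)"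

end

theory Submission
  imports Defs
begin

text \<open>
  Without biproducts, \<open>!A \<otimes> !A\<close> stands in for \<open>A \<times> A\<close>. The arrows \<open>p = \<epsilon> \<otimes> e\<close> and \<open>q = e \<otimes> \<epsilon>\<close>
  play the role of the projections, so \<open>p + q\<close> that of the addition, and there is an arrow
  \<open>\<omega> : !A \<otimes> !A \<rightarrow> !(!A \<otimes> !A)\<close> with \<open>\<omega> \<cdot> !(p + q) = \<nabla>\<close> and \<open>\<omega> \<cdot> \<Delta> \<cdot> (!p \<otimes> !q) = 1\<close>. On power
  series, \<open>\<omega>\<close> sends \<open>exp x \<otimes> exp y\<close> to \<open>exp (exp x \<otimes> 1 + 1 \<otimes> exp y)\<close>.

  For a deriving transformation \<open>d\<close> with \<open>\<eta> = (u \<otimes> 1) \<cdot> d\<close>, the arrow \<open>w = u \<otimes> \<eta>\<close> embeds \<open>A\<close> as the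
  second summand: \<open>w \<cdot> p = 0\<close> and \<open>w \<cdot> q = 1\<close>. Hence \<open>\<nabla> \<otimes> 1 = (\<omega> \<otimes> w) \<cdot> (!(p + q) \<otimes> (p + q))\<close>, and
  naturality of \<open>d\<close> at \<open>p + q\<close>, additivity \<open>!(p + q) = \<Delta> \<cdot> (!p \<otimes> !q) \<cdot> \<nabla>\<close> and the product rule
  turn \<open>(\<nabla> \<otimes> 1) \<cdot> d\<close> into two summands. The one that differentiates along \<open>w \<cdot> p\<close> vanishes; the
  other one is \<open>(1 \<otimes> d) \<cdot> \<nabla>\<close>. Precomposing this rule with \<open>1 \<otimes> u \<otimes> 1\<close> recovers \<open>d\<close> from \<open>\<eta>\<close>.
\<close>

section \<open>Calculus of arrows: typing, interchange, symmetry and sums\<close>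

context category
begin

text \<open>Typing is carried by equations for \<open>Dom\<close> and \<open>Cod\<close>, which the
  simplifier can compute, instead of membership in \<open>Hom\<close> with intermediate objects to
  be guessed. Laws with the suffix \<open>_Arr\<close> are restated in this form.\<close>

lemma Hom_iff: "f \<in> Hom C A B \<longleftrightarrow> f \<in> Arr C \<and> Dom C f = A \<and> Cod C f = B"
  by (simp add: Hom_def)

declare Dom_Obj [simp] Cod_Obj [simp]

lemma Id_type [simp]:
  assumes "A \<in> Obj C"
  shows "\<one> A \<in> Arr C" "Dom C (\<one> A) = A" "Cod C (\<one> A) = A"
  using Id_Hom [OF assms] by (auto simp: Hom_iff)

lemma Comp_type [simp]:
  assumes "f \<in> Arr C" "g \<in> Arr C" "Cod C f = Dom C g"
  shows "f \<cdot> g \<in> Arr C" "Dom C (f \<cdot> g) = Dom C f" "Cod C (f \<cdot> g) = Cod C g"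
  using Comp_Hom [of f "Dom C f" "Cod C f" g "Cod C g"] assms by (auto simp: Hom_iff)

lemma Id_Comp_Arr [simp]: "\<lbrakk>f \<in> Arr C; Dom C f = A\<rbrakk> \<Longrightarrow> \<one> A \<cdot> f = f"
  using Id_Comp by (auto simp: Hom_iff)

lemma Comp_Id_Arr [simp]: "\<lbrakk>f \<in> Arr C; Cod C f = A\<rbrakk> \<Longrightarrow> f \<cdot> \<one> A = f"
  using Comp_Id by (auto simp: Hom_iff)

lemma Comp_assoc_Arr [simp]:
  "\<lbrakk>f \<in> Arr C; g \<in> Arr C; h \<in> Arr C; Cod C f = Dom C g; Cod C g = Dom C h\<rbrakk>
    \<Longrightarrow> (f \<cdot> g) \<cdot> h = f \<cdot> (g \<cdot> h)"
  using Comp_assoc by (auto simp: Hom_iff)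

end

context strict_monoidal_category
begin

declare Unit_Obj [simp] TensorO_Obj [simp] TensorO_assoc [simp] TensorA_assoc [simp]
  Unit_TensorO [simp] TensorO_Unit [simp] Unit_TensorA [simp] TensorA_Unit [simp]
  TensorA_Id [simp]

lemma TensorA_type [simp]:
  assumes "f \<in> Arr C" "g \<in> Arr C"
  shows "f \<otimes> g \<in> Arr C" "Dom C (f \<otimes> g) = Dom C f \<odot> Dom C g"
    "Cod C (f \<otimes> g) = Cod C f \<odot> Cod C g"
  using TensorA_Hom [of f "Dom C f" "Cod C f" g "Dom C g" "Cod C g"] assms
  by (auto simp: Hom_iff)

lemma interchange:
  "\<lbrakk>f \<in> Arr C; f' \<in> Arr C; g \<in> Arr C; g' \<in> Arr C; Cod C f = Dom C f'; Cod C g = Dom C g'\<rbrakk>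
    \<Longrightarrow> (f \<otimes> g) \<cdot> (f' \<otimes> g') = (f \<cdot> f') \<otimes> (g \<cdot> g')"
  using TensorA_Comp by (auto simp: Hom_iff)

text \<open>Composites are normalised to the right, so plain \<open>interchange\<close> does not
  match once a further factor \<open>h\<close> follows; this variant does.\<close>

lemma interchange_assoc:
  assumes "f \<in> Arr C" "f' \<in> Arr C" "g \<in> Arr C" "g' \<in> Arr C" "h \<in> Arr C"
    "Cod C f = Dom C f'" "Cod C g = Dom C g'" "Cod C f' \<odot> Cod C g' = Dom C h"
  shows "(f \<otimes> g) \<cdot> ((f' \<otimes> g') \<cdot> h) = ((f \<cdot> f') \<otimes> (g \<cdot> g')) \<cdot> h"
proof -
  have "(f \<otimes> g) \<cdot> ((f' \<otimes> g') \<cdot> h) = ((f \<otimes> g) \<cdot> (f' \<otimes> g')) \<cdot> h"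
    using assms by simp
  then show ?thesis
    using assms by (simp add: interchange)
qed

end

context strict_symmetric_monoidal_category
begin

lemma Sym_type [simp]:
  assumes "A \<in> Obj C" "B \<in> Obj C"
  shows "\<sigma> A B \<in> Arr C" "Dom C (\<sigma> A B) = A \<odot> B" "Cod C (\<sigma> A B) = B \<odot> A"
  using Sym_Hom [OF assms] by (auto simp: Hom_iff)

lemma Sym_slide:
  "\<lbrakk>f \<in> Arr C; g \<in> Arr C; Cod C f = A; Cod C g = B\<rbrakk>
    \<Longrightarrow> (f \<otimes> g) \<cdot> \<sigma> A B = \<sigma> (Dom C f) (Dom C g) \<cdot> (g \<otimes> f)"
  using Sym_natural by (auto simp: Hom_iff)

text \<open>The hexagon makes \<open>\<sigma> A \<K>\<close> idempotent, and it is invertible.\<close>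

lemma Sym_Unit [simp]:
  assumes A: "A \<in> Obj C"
  shows "\<sigma> A \<K> = \<one> A"
proof -
  have idem: "\<sigma> A \<K> = \<sigma> A \<K> \<cdot> \<sigma> A \<K>"
    using Sym_hexagon [of A \<K> \<K>] A by simp
  have "\<sigma> A \<K> \<cdot> (\<sigma> A \<K> \<cdot> \<sigma> \<K> A) = (\<sigma> A \<K> \<cdot> \<sigma> A \<K>) \<cdot> \<sigma> \<K> A"
    using A by simp
  then show ?thesis
    using A Sym_involutive [of A \<K>] by (simp flip: idem)
qed

lemma Unit_Sym [simp]: "A \<in> Obj C \<Longrightarrow> \<sigma> \<K> A = \<one> A"
  using Sym_involutive [of \<K> A] by simp

text \<open>Naturality of the symmetry, whiskered on both sides. It moves four arrows past the
  middle swap in \<open>nabla_\<Delta>\<close>; the tensors are nested to the right as in the normal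
  form of the simplifier.\<close>

lemma middle_swap:
  assumes "f \<in> Arr C" "g \<in> Arr C" "h \<in> Arr C" "k \<in> Arr C"
    and "Cod C f = A" "Cod C g = B" "Cod C h = D" "Cod C k = E"
  shows "(f \<otimes> (g \<otimes> (h \<otimes> k))) \<cdot> (\<one> A \<otimes> (\<sigma> B D \<otimes> \<one> E))
    = (\<one> (Dom C f) \<otimes> (\<sigma> (Dom C g) (Dom C h) \<otimes> \<one> (Dom C k))) \<cdot> (f \<otimes> (h \<otimes> (g \<otimes> k)))"
proof -
  have "A \<in> Obj C" "B \<in> Obj C" "D \<in> Obj C" "E \<in> Obj C"
    using assms by auto
  moreover have "((g \<otimes> h) \<otimes> k) \<cdot> (\<sigma> B D \<otimes> \<one> E)
      = (\<sigma> (Dom C g) (Dom C h) \<otimes> \<one> (Dom C k)) \<cdot> ((h \<otimes> g) \<otimes> k)"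
    using assms calculation
    by (subst (1 2) interchange) (auto simp: Sym_slide)
  ultimately show ?thesis
    using assms by (simp add: interchange)
qed

end

context additive_symmetric_monoidal_category
begin

lemma Zero_type [simp]:
  assumes "A \<in> Obj C" "B \<in> Obj C"
  shows "\<zero> A B \<in> Arr C" "Dom C (\<zero> A B) = A" "Cod C (\<zero> A B) = B"
  using Zero_Hom [OF assms] by (auto simp: Hom_iff)

lemma Plus_type [simp]:
  assumes "f \<in> Arr C" "g \<in> Arr C" "Dom C f = Dom C g" "Cod C f = Cod C g"
  shows "f \<oplus> g \<in> Arr C" "Dom C (f \<oplus> g) = Dom C g" "Cod C (f \<oplus> g) = Cod C g"
  using Plus_Hom [of f "Dom C g" "Cod C g" g] assms by (auto simp: Hom_iff)

lemma Zero_Plus_Arr [simp]: "\<lbrakk>f \<in> Arr C; Dom C f = A; Cod C f = B\<rbrakk> \<Longrightarrow> \<zero> A B \<oplus> f = f"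
  using Zero_Plus by (auto simp: Hom_iff)

lemma Plus_Zero_Arr [simp]: "\<lbrakk>f \<in> Arr C; Dom C f = A; Cod C f = B\<rbrakk> \<Longrightarrow> f \<oplus> \<zero> A B = f"
  using Zero_Plus_Arr [of f A B] Plus_commute [of f A B "\<zero> A B"] by (auto simp: Hom_iff)

lemma Plus_commute_Arr:
  "\<lbrakk>f \<in> Arr C; g \<in> Arr C; Dom C f = Dom C g; Cod C f = Cod C g\<rbrakk> \<Longrightarrow> f \<oplus> g = g \<oplus> f"
  using Plus_commute [of f "Dom C g" "Cod C g" g] by (auto simp: Hom_iff)

lemma Comp_Plus_Arr [simp]:
  "\<lbrakk>f \<in> Arr C; g \<in> Arr C; h \<in> Arr C; Dom C g = Dom C h; Cod C g = Cod C h; Cod C f = Dom C h\<rbrakk>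
    \<Longrightarrow> f \<cdot> (g \<oplus> h) = (f \<cdot> g) \<oplus> (f \<cdot> h)"
  using Comp_Plus by (auto simp: Hom_iff)

lemma Plus_Comp_Arr [simp]:
  "\<lbrakk>f \<in> Arr C; g \<in> Arr C; h \<in> Arr C; Dom C f = Dom C g; Cod C f = Cod C g; Cod C g = Dom C h\<rbrakk>
    \<Longrightarrow> (f \<oplus> g) \<cdot> h = (f \<cdot> h) \<oplus> (g \<cdot> h)"
  using Plus_Comp by (auto simp: Hom_iff)

lemma TensorA_Plus_Arr [simp]:
  "\<lbrakk>f \<in> Arr C; g \<in> Arr C; h \<in> Arr C; Dom C g = Dom C h; Cod C g = Cod C h\<rbrakk>
    \<Longrightarrow> f \<otimes> (g \<oplus> h) = (f \<otimes> g) \<oplus> (f \<otimes> h)"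
  using TensorA_Plus by (auto simp: Hom_iff)

lemma Plus_TensorA_Arr [simp]:
  "\<lbrakk>f \<in> Arr C; g \<in> Arr C; h \<in> Arr C; Dom C f = Dom C g; Cod C f = Cod C g\<rbrakk>
    \<Longrightarrow> (f \<oplus> g) \<otimes> h = (f \<otimes> h) \<oplus> (g \<otimes> h)"
  using Plus_TensorA by (auto simp: Hom_iff)

lemma Zero_absorb [simp]:
  assumes "f \<in> Arr C" "A \<in> Obj C" "B \<in> Obj C"
  shows "Cod C f = A \<Longrightarrow> f \<cdot> \<zero> A B = \<zero> (Dom C f) B"
    and "Dom C f = B \<Longrightarrow> \<zero> A B \<cdot> f = \<zero> A (Cod C f)"
    and "f \<otimes> \<zero> A B = \<zero> (Dom C f \<odot> A) (Cod C f \<odot> B)"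
    and "\<zero> A B \<otimes> f = \<zero> (A \<odot> Dom C f) (B \<odot> Cod C f)"
  using assms Comp_Zero [of f "Dom C f" A B] Zero_Comp [of A f B "Cod C f"]
    TensorA_Zero [of f "Dom C f" "Cod C f" A B] Zero_TensorA [of A B f "Dom C f" "Cod C f"]
  by (auto simp: Hom_iff)

end

section \<open>Consequences of the modality axioms\<close>

context endofunctor
begin

declare bangO_Obj [simp] bangA_Id [simp]

lemma bangA_type [simp]:
  assumes "f \<in> Arr C"
  shows "bangA f \<in> Arr C" "Dom C (bangA f) = bangO (Dom C f)" "Cod C (bangA f) = bangO (Cod C f)"
  using bangA_Hom [of f "Dom C f" "Cod C f"] assms by (auto simp: Hom_iff)

lemma bangA_Comp_Arr:
  "\<lbrakk>f \<in> Arr C; g \<in> Arr C; Cod C f = Dom C g\<rbrakk> \<Longrightarrow> bangA f \<cdot> bangA g = bangA (f \<cdot> g)"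
  using bangA_Comp by (auto simp: Hom_iff)

end

context coalgebra_modality
begin

lemma coalgebra_modality_type [simp]:
  assumes "A \<in> Obj C"
  shows "\<delta> A \<in> Arr C" "Dom C (\<delta> A) = bangO A" "Cod C (\<delta> A) = bangO (bangO A)"
    and "\<epsilon> A \<in> Arr C" "Dom C (\<epsilon> A) = bangO A" "Cod C (\<epsilon> A) = A"
    and "\<Delta> A \<in> Arr C" "Dom C (\<Delta> A) = bangO A" "Cod C (\<Delta> A) = bangO A \<odot> bangO A"
    and "e A \<in> Arr C" "Dom C (e A) = bangO A" "Cod C (e A) = \<K>"
  using \<delta>_Hom [OF assms] \<epsilon>_Hom [OF assms] \<Delta>_Hom [OF assms] e_Hom [OF assms]
  by (auto simp: Hom_iff)

text \<open>Naturality of \<open>e\<close> at \<open>\<epsilon> A\<close> splits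
  \<open>e (bangO A)\<close> into \<open>bangA (\<epsilon> A) \<cdot> e A\<close>, and a counit law
  of the comonad cancels the first factor against \<open>\<delta> A\<close>.\<close>

lemma \<delta>_e:
  assumes A: "A \<in> Obj C"
  shows "\<delta> A \<cdot> e (bangO A) = e A"
proof -
  have "\<delta> A \<cdot> e (bangO A) = \<delta> A \<cdot> bangA (\<epsilon> A) \<cdot> e A"
    using A e_natural [of "\<epsilon> A" "bangO A" A] by (simp add: Hom_iff)
  then show ?thesis
    using A \<delta>_bang_\<epsilon> [OF A] by simp
qed

end

context bialgebra_modality
begin

lemma bialgebra_modality_type [simp]:
  assumes "A \<in> Obj C"
  shows "nabla A \<in> Arr C" "Dom C (nabla A) = bangO A \<odot> bangO A" "Cod C (nabla A) = bangO A"
    and "u A \<in> Arr C" "Dom C (u A) = \<K>" "Cod C (u A) = bangO A"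
  using nabla_Hom [OF assms] u_Hom [OF assms] by (auto simp: Hom_iff)

text \<open>With \<open>h\<close> the codereliction, this matches the initial segments of the two
  chain rules; both directions of the correspondence use it.\<close>

lemma \<Delta>_tensor_nabla:
  assumes "A \<in> Obj C" "h \<in> Arr C" "Dom C h = A" "Cod C h = bangO A"
  shows "(\<Delta> A \<otimes> h) \<cdot> (\<one> (bangO A) \<otimes> nabla A)
    = (\<Delta> A \<otimes> \<one> A) \<cdot> (\<one> (bangO A) \<otimes> ((\<one> (bangO A) \<otimes> h) \<cdot> nabla A))"
proof -
  have "\<one> (bangO A) \<otimes> ((\<one> (bangO A) \<otimes> h) \<cdot> nabla A)
      = (\<one> (bangO A \<odot> bangO A) \<otimes> h) \<cdot> (\<one> (bangO A) \<otimes> nabla A)"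
    using assms interchange [of "\<one> (bangO A)" "\<one> (bangO A)" "\<one> (bangO A) \<otimes> h" "nabla A"]
    by (simp flip: TensorA_Id)
  then show ?thesis
    using assms by (simp add: interchange_assoc)
qed

text \<open>By naturality \<open>u\<close> absorbs \<open>bangA (\<zero> A A)\<close>, and
  naturality of \<open>\<epsilon>\<close> then turns that factor into composition with zero.\<close>

lemma u_\<epsilon>:
  assumes A: "A \<in> Obj C"
  shows "u A \<cdot> \<epsilon> A = \<zero> \<K> A"
proof -
  have "u A \<cdot> \<epsilon> A = u A \<cdot> bangA (\<zero> A A) \<cdot> \<epsilon> A"
    using A u_natural [of "\<zero> A A" A A] by (simp add: Hom_iff)
  also have "\<dots> = u A \<cdot> (\<epsilon> A \<cdot> \<zero> A A)"
    using A \<epsilon>_natural [of "\<zero> A A" A A] by (simp add: Hom_iff)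
  also have "\<dots> = \<zero> \<K> A"
    using A by simp
  finally show ?thesis .
qed

end


section \<open>The substitute for a biproduct and the arrow \<open>\<omega>\<close>\<close>

context additive_bialgebra_modality
begin

definition p where "p A = \<epsilon> A \<otimes> e A"
definition q where "q A = e A \<otimes> \<epsilon> A"
text \<open>The inclusions of \<open>bangO A\<close> into \<open>bangO A \<odot> bangO A\<close>
  given by the unit \<open>u\<close>, lifted along \<open>\<delta>\<close> to comonoid morphisms.
  They replace the images under the functor of the injections into a biproduct, and
  \<open>\<omega>\<close> combines them as the inverse Seely map
  \<open>!A \<otimes> !A \<rightarrow> !(A \<times> A)\<close> combines those images.\<close>

definition inl where "inl A = \<delta> A \<cdot> bangA (\<one> (bangO A) \<otimes> u A)"
definition inr where "inr A = \<delta> A \<cdot> bangA (u A \<otimes> \<one> (bangO A))"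
definition \<omega> where "\<omega> A = (inl A \<otimes> inr A) \<cdot> nabla (bangO A \<odot> bangO A)"

lemma auxiliary_type [simp]:
  assumes "A \<in> Obj C"
  shows "p A \<in> Arr C" "Dom C (p A) = bangO A \<odot> bangO A" "Cod C (p A) = A"
    and "q A \<in> Arr C" "Dom C (q A) = bangO A \<odot> bangO A" "Cod C (q A) = A"
    and "inl A \<in> Arr C" "Dom C (inl A) = bangO A" "Cod C (inl A) = bangO (bangO A \<odot> bangO A)"
    and "inr A \<in> Arr C" "Dom C (inr A) = bangO A" "Cod C (inr A) = bangO (bangO A \<odot> bangO A)"
    and "\<omega> A \<in> Arr C" "Dom C (\<omega> A) = bangO A \<odot> bangO A"
      "Cod C (\<omega> A) = bangO (bangO A \<odot> bangO A)"
  using assms by (auto simp: p_def q_def inl_def inr_def \<omega>_def)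

text \<open>An injection followed by a projection is 1 or 0, and \<open>e A \<cdot> u A\<close> is
  the value of \<open>bangA\<close> at zero. The relations \<open>u_e\<close> and
  \<open>u_\<epsilon>\<close> evaluate the composites under \<open>bangA\<close>, and
  \<open>\<delta>\<close> cancels by a counit law or is absorbed by \<open>e\<close>.\<close>

lemma inl_inr_bang:
  assumes A: "A \<in> Obj C"
  shows "inl A \<cdot> bangA (p A) = \<one> (bangO A)" "inl A \<cdot> bangA (q A) = e A \<cdot> u A"
    and "inr A \<cdot> bangA (p A) = e A \<cdot> u A" "inr A \<cdot> bangA (q A) = \<one> (bangO A)"
proof -
  have 0: "\<delta> A \<cdot> (e (bangO A) \<cdot> u A) = e A \<cdot> u A"
    using A \<delta>_e [OF A] Comp_assoc_Arr [of "\<delta> A" "e (bangO A)" "u A"] by simp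
  show "inl A \<cdot> bangA (p A) = \<one> (bangO A)" "inl A \<cdot> bangA (q A) = e A \<cdot> u A"
    "inr A \<cdot> bangA (p A) = e A \<cdot> u A" "inr A \<cdot> bangA (q A) = \<one> (bangO A)"
    using A u_e [OF A] u_\<epsilon> [OF A] \<delta>_bang_\<epsilon> [OF A] 0
    by (simp_all add: inl_def inr_def p_def q_def bangA_Comp_Arr interchange bangA_Zero)
qed

text \<open>Each inclusion followed by \<open>p A \<oplus> q A\<close> is
  \<open>\<epsilon> A\<close>, as \<open>u_\<epsilon>\<close> kills the other summand; hence both
  lifts become identities once naturality of \<open>nabla\<close> lets the sum act on each
  factor.\<close>

lemma \<omega>_bang_sum:
  assumes A: "A \<in> Obj C"
  shows "\<omega> A \<cdot> bangA (p A \<oplus> q A) = nabla A"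
proof -
  let ?f = "p A \<oplus> q A"
  have l: "inl A \<cdot> bangA ?f = \<one> (bangO A)"
    using A u_e [OF A] u_\<epsilon> [OF A] \<delta>_bang_\<epsilon> [OF A]
    by (simp add: inl_def p_def q_def bangA_Comp_Arr interchange)
  have r: "inr A \<cdot> bangA ?f = \<one> (bangO A)"
    using A u_e [OF A] u_\<epsilon> [OF A] \<delta>_bang_\<epsilon> [OF A]
    by (simp add: inr_def p_def q_def bangA_Comp_Arr interchange)
  have "\<omega> A \<cdot> bangA ?f = (inl A \<otimes> inr A) \<cdot> ((bangA ?f \<otimes> bangA ?f) \<cdot> nabla A)"
    using A nabla_natural [of ?f "bangO A \<odot> bangO A" A] by (simp add: \<omega>_def Hom_iff)
  also have "\<dots> = nabla A"
    using A l r by (simp add: interchange_assoc)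
  finally show ?thesis .
qed

text \<open>Every arrow \<open>\<delta> A \<cdot> bangA g\<close> is compatible with
  \<open>\<Delta>\<close>, because \<open>\<delta>\<close> is and \<open>\<Delta>\<close> is
  natural.\<close>

lemma inl_inr_\<Delta>:
  assumes A: "A \<in> Obj C"
  shows "inl A \<cdot> \<Delta> (bangO A \<odot> bangO A) = \<Delta> A \<cdot> (inl A \<otimes> inl A)"
    and "inr A \<cdot> \<Delta> (bangO A \<odot> bangO A) = \<Delta> A \<cdot> (inr A \<otimes> inr A)"
proof -
  have *: "\<delta> A \<cdot> bangA g \<cdot> \<Delta> (bangO A \<odot> bangO A) = \<Delta> A \<cdot> ((\<delta> A \<cdot> bangA g) \<otimes> (\<delta> A \<cdot> bangA g))"
    if g: "g \<in> Arr C" "Dom C g = bangO A" "Cod C g = bangO A \<odot> bangO A" for g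
  proof -
    have "\<delta> A \<cdot> bangA g \<cdot> \<Delta> (bangO A \<odot> bangO A) = \<delta> A \<cdot> \<Delta> (bangO A) \<cdot> (bangA g \<otimes> bangA g)"
      using A g \<Delta>_natural [of g "bangO A" "bangO A \<odot> bangO A"] by (simp add: Hom_iff)
    also have "\<dots> = \<Delta> A \<cdot> ((\<delta> A \<cdot> bangA g) \<otimes> (\<delta> A \<cdot> bangA g))"
      unfolding \<delta>_\<Delta> [OF A] using A g by (simp add: interchange)
    finally show ?thesis .
  qed
  show "inl A \<cdot> \<Delta> (bangO A \<odot> bangO A) = \<Delta> A \<cdot> (inl A \<otimes> inl A)"
    "inr A \<cdot> \<Delta> (bangO A \<odot> bangO A) = \<Delta> A \<cdot> (inr A \<otimes> inr A)"
    unfolding inl_def inr_def by (intro * ; use A in simp)+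
qed

text \<open>The bialgebra law turns \<open>nabla\<close> followed by \<open>\<Delta>\<close> into
  two copies of each lift. Under \<open>p\<close> only the left lift survives, under
  \<open>q\<close> only the right one, and the counit laws remove the discarded copies.\<close>

lemma \<omega>_\<Delta>_bang:
  assumes A: "A \<in> Obj C"
  shows "\<omega> A \<cdot> (\<Delta> (bangO A \<odot> bangO A) \<cdot> (bangA (p A) \<otimes> bangA (q A))) = \<one> (bangO A \<odot> bangO A)"
proof -
  let ?B = "bangO A \<odot> bangO A"
  let ?I = "\<one> (bangO A)"
  let ?i = "inl A" and ?j = "inr A" and ?P = "bangA (p A)" and ?Q = "bangA (q A)"
  let ?s = "?I \<otimes> (\<sigma> (bangO A) (bangO A) \<otimes> ?I)"
  have B: "?B \<in> Obj C" using A by simp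
  \<comment> \<open>Multiplying by \<open>e A \<cdot> u A\<close> erases that factor, by the unit
    laws of \<open>nabla\<close>.\<close>
  have eu: "(?I \<otimes> (e A \<cdot> u A)) \<cdot> nabla A = ?I \<otimes> e A" "((e A \<cdot> u A) \<otimes> ?I) \<cdot> nabla A = e A \<otimes> ?I"
  proof -
    have "(?I \<otimes> (e A \<cdot> u A)) \<cdot> nabla A = (?I \<otimes> e A) \<cdot> ((?I \<otimes> u A) \<cdot> nabla A)"
      using A by (simp add: interchange_assoc)
    then show "(?I \<otimes> (e A \<cdot> u A)) \<cdot> nabla A = ?I \<otimes> e A"
      using A nabla_unit_right [OF A] by simp
    have "((e A \<cdot> u A) \<otimes> ?I) \<cdot> nabla A = (e A \<otimes> ?I) \<cdot> ((u A \<otimes> ?I) \<cdot> nabla A)"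
      using A by (simp add: interchange_assoc)
    then show "((e A \<cdot> u A) \<otimes> ?I) \<cdot> nabla A = e A \<otimes> ?I"
      using A nabla_unit_left [OF A] by simp
  qed
  have "\<omega> A \<cdot> (\<Delta> ?B \<cdot> (?P \<otimes> ?Q)) = (?i \<otimes> ?j) \<cdot> ((nabla ?B \<cdot> \<Delta> ?B) \<cdot> (?P \<otimes> ?Q))"
    using A by (simp add: \<omega>_def)
  also have "\<dots> = ((?i \<cdot> \<Delta> ?B) \<otimes> (?j \<cdot> \<Delta> ?B)) \<cdot>
      ((\<one> (bangO ?B) \<otimes> (\<sigma> (bangO ?B) (bangO ?B) \<otimes> \<one> (bangO ?B))) \<cdot>
       ((nabla ?B \<cdot> ?P) \<otimes> (nabla ?B \<cdot> ?Q)))"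
    unfolding nabla_\<Delta> [OF B] using A by (simp add: interchange interchange_assoc)
  also have "\<dots> = ((\<Delta> A \<otimes> \<Delta> A) \<cdot> ((?i \<otimes> (?i \<otimes> (?j \<otimes> ?j))) \<cdot>
      (\<one> (bangO ?B) \<otimes> (\<sigma> (bangO ?B) (bangO ?B) \<otimes> \<one> (bangO ?B))))) \<cdot>
       ((nabla ?B \<cdot> ?P) \<otimes> (nabla ?B \<cdot> ?Q))"
    unfolding inl_inr_\<Delta> [OF A] using A
    by (simp flip: interchange [of "\<Delta> A" "?i \<otimes> ?i" "\<Delta> A" "?j \<otimes> ?j"])
  also have "\<dots> = (\<Delta> A \<otimes> \<Delta> A) \<cdot> (?s \<cdot> (((?i \<otimes> ?j) \<otimes> (?i \<otimes> ?j)) \<cdot>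
       ((nabla ?B \<cdot> ?P) \<otimes> (nabla ?B \<cdot> ?Q))))"
    using A by (simp add: middle_swap del: TensorA_Id)
  also have "((?i \<otimes> ?j) \<otimes> (?i \<otimes> ?j)) \<cdot> ((nabla ?B \<cdot> ?P) \<otimes> (nabla ?B \<cdot> ?Q))
      = ((?i \<otimes> ?j) \<cdot> (nabla ?B \<cdot> ?P)) \<otimes> ((?i \<otimes> ?j) \<cdot> (nabla ?B \<cdot> ?Q))"
    using A by (intro interchange) auto
  also have "(?i \<otimes> ?j) \<cdot> (nabla ?B \<cdot> ?P) = ?I \<otimes> e A"
    using A nabla_natural [of "p A" ?B A, symmetric] eu
    by (simp add: interchange_assoc inl_inr_bang Hom_iff)
  also have "(?i \<otimes> ?j) \<cdot> (nabla ?B \<cdot> ?Q) = e A \<otimes> ?I"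
    using A nabla_natural [of "q A" ?B A, symmetric] eu
    by (simp add: interchange_assoc inl_inr_bang Hom_iff)
  \<comment> \<open>Both swapped factors are sent to the unit object by \<open>e\<close>, where the
    symmetry is an identity.\<close>
  also have "?s \<cdot> ((?I \<otimes> e A) \<otimes> (e A \<otimes> ?I)) = (?I \<otimes> e A) \<otimes> (e A \<otimes> ?I)"
    using A middle_swap [of ?I "e A" "e A" ?I "bangO A" \<K> \<K> "bangO A"] by simp
  also have "(\<Delta> A \<otimes> \<Delta> A) \<cdot> ((?I \<otimes> e A) \<otimes> (e A \<otimes> ?I)) = \<one> ?B"
    using A interchange [of "\<Delta> A" "?I \<otimes> e A" "\<Delta> A" "e A \<otimes> ?I"]
      \<Delta>_counit_left [OF A] \<Delta>_counit_right [OF A] by simp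
  finally show ?thesis .
qed

end

section \<open>From deriving transformations to coderelictions\<close>

locale deriving_transformation_on_additive_bialgebra_modality =
  additive_bialgebra_modality C bangO bangA \<delta> \<epsilon> \<Delta> e nabla u
  + deriving_transformation C bangO bangA \<delta> \<epsilon> \<Delta> e d
  for C :: "('o, 'a, 'x) additive_smc_data_scheme" (structure)
    and bangO bangA \<delta> \<epsilon> \<Delta> e nabla u d
begin

lemma d_type [simp]:
  assumes "A \<in> Obj C"
  shows "d A \<in> Arr C" "Dom C (d A) = bangO A \<odot> A" "Cod C (d A) = bangO A"
  using d_Hom [OF assms] by (auto simp: Hom_iff)

abbreviation \<eta> where "\<eta> \<equiv> codereliction_of C u d"

lemma \<eta>_def: "A \<in> Obj C \<Longrightarrow> \<eta> A = (u A \<otimes> \<one> A) \<cdot> d A"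
  by (simp add: codereliction_of_def)

lemma \<eta>_type [simp]:
  assumes "A \<in> Obj C"
  shows "\<eta> A \<in> Arr C" "Dom C (\<eta> A) = A" "Cod C (\<eta> A) = bangO A"
  using assms by (auto simp: \<eta>_def)

lemma \<eta>_e_eq:
  assumes A: "A \<in> Obj C"
  shows "\<eta> A \<cdot> e A = \<zero> A \<K>"
  using A constant_rule [OF A] by (simp add: \<eta>_def)

lemma \<eta>_\<epsilon>_eq:
  assumes A: "A \<in> Obj C"
  shows "\<eta> A \<cdot> \<epsilon> A = \<one> A"
  using A linear_rule [OF A] u_e [OF A] by (simp add: \<eta>_def interchange)

lemma nabla_rule:
  assumes A: "A \<in> Obj C"
  shows "(nabla A \<otimes> \<one> A) \<cdot> d A = (\<one> (bangO A) \<otimes> d A) \<cdot> nabla A"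
proof -
  let ?B = "bangO A \<odot> bangO A"
  let ?I = "\<one> (bangO A)"
  let ?P = "bangA (p A)" and ?Q = "bangA (q A)"
  let ?f = "p A \<oplus> q A" and ?w = "u A \<otimes> \<eta> A"
  have B: "?B \<in> Obj C" using A by simp
  have wp: "?w \<cdot> p A = \<zero> A A"
    using A u_\<epsilon> [OF A] \<eta>_e_eq [OF A] by (simp add: p_def interchange)
  have wq: "?w \<cdot> q A = \<one> A"
    using A u_e [OF A] \<eta>_\<epsilon>_eq [OF A] by (simp add: q_def interchange)
  have wf: "?w \<cdot> ?f = \<one> A"
    using A wp wq by simp
  have dP: "d ?B \<cdot> ?P = (?P \<otimes> p A) \<cdot> d A" and dQ: "d ?B \<cdot> ?Q = (?Q \<otimes> q A) \<cdot> d A"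
    using A d_natural [of "p A" ?B A] d_natural [of "q A" ?B A] by (simp_all add: Hom_iff)
  \<comment> \<open>The summand that differentiates the second copy: naturality at
    \<open>q A\<close> makes \<open>?w \<cdot> q A\<close> the direction, and the rest collapses by
    \<open>\<omega>_\<Delta>_bang\<close>.\<close>
  have first: "(\<omega> A \<otimes> ?w) \<cdot> ((\<Delta> ?B \<otimes> \<one> ?B) \<cdot> (?P \<otimes> (d ?B \<cdot> ?Q))) = ?I \<otimes> d A"
  proof -
    have "(\<omega> A \<otimes> ?w) \<cdot> ((\<Delta> ?B \<otimes> \<one> ?B) \<cdot> (?P \<otimes> (d ?B \<cdot> ?Q)))
        = (\<omega> A \<otimes> ?w) \<cdot> ((\<Delta> ?B \<otimes> \<one> ?B) \<cdot> (((?P \<otimes> ?Q) \<otimes> q A) \<cdot> (?I \<otimes> d A)))"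
      unfolding dQ using A by (simp add: interchange)
    also have "\<dots> = ((\<omega> A \<cdot> (\<Delta> ?B \<cdot> (?P \<otimes> ?Q))) \<otimes> (?w \<cdot> q A)) \<cdot> (?I \<otimes> d A)"
      using A by (simp add: interchange_assoc del: TensorA_assoc TensorA_Id)
    finally show ?thesis
      using A by (simp add: \<omega>_\<Delta>_bang wq)
  qed
  \<comment> \<open>The summand that differentiates the first copy: once \<open>p A\<close> slides
    past the symmetry, the direction is \<open>?w \<cdot> p A\<close>, which is zero.\<close>
  have second: "(\<omega> A \<otimes> ?w) \<cdot> ((\<Delta> ?B \<otimes> \<one> ?B) \<cdot> ((\<one> (bangO ?B) \<otimes> \<sigma> (bangO ?B) ?B)
      \<cdot> ((d ?B \<cdot> ?P) \<otimes> ?Q))) = \<zero> (?B \<odot> A) ?B"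
  proof -
    have "(\<one> (bangO ?B) \<otimes> \<sigma> (bangO ?B) ?B) \<cdot> ((d ?B \<cdot> ?P) \<otimes> ?Q)
        = (\<one> (bangO ?B) \<otimes> \<sigma> (bangO ?B) ?B) \<cdot> ((?P \<otimes> (p A \<otimes> ?Q)) \<cdot> (d A \<otimes> ?I))"
      unfolding dP using A interchange [of "?P \<otimes> p A" "d A" ?Q ?I] by simp
    also have "\<dots> = (?P \<otimes> (\<sigma> (bangO ?B) ?B \<cdot> (p A \<otimes> ?Q))) \<cdot> (d A \<otimes> ?I)"
      using A by (simp add: interchange_assoc)
    also have "\<dots> = (?P \<otimes> ((?Q \<otimes> p A) \<cdot> \<sigma> (bangO A) A)) \<cdot> (d A \<otimes> ?I)"
      using A Sym_slide [of ?Q "p A"] by simp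
    also have "\<dots> = ((?P \<otimes> ?Q) \<otimes> p A) \<cdot> ((?I \<otimes> \<sigma> (bangO A) A) \<cdot> (d A \<otimes> ?I))"
      using A by (simp add: interchange_assoc)
    finally have "(\<omega> A \<otimes> ?w) \<cdot> ((\<Delta> ?B \<otimes> \<one> ?B) \<cdot> ((\<one> (bangO ?B) \<otimes> \<sigma> (bangO ?B) ?B)
      \<cdot> ((d ?B \<cdot> ?P) \<otimes> ?Q))) = ((\<omega> A \<cdot> (\<Delta> ?B \<cdot> (?P \<otimes> ?Q))) \<otimes> (?w \<cdot> p A))
        \<cdot> ((?I \<otimes> \<sigma> (bangO A) A) \<cdot> (d A \<otimes> ?I))"
      using A by (simp add: interchange_assoc del: TensorA_assoc TensorA_Id)
    then show ?thesis
      using A by (simp add: \<omega>_\<Delta>_bang wp)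
  qed
  \<comment> \<open>The sum \<open>?f\<close> is kept unexpanded here, so that naturality of
    \<open>d\<close> applies to it as a single arrow.\<close>
  have "(nabla A \<otimes> \<one> A) \<cdot> d A = (\<omega> A \<otimes> ?w) \<cdot> ((bangA ?f \<otimes> ?f) \<cdot> d A)"
    using A interchange [of "\<omega> A" "bangA ?f" ?w ?f]
    by (simp add: interchange_assoc \<omega>_bang_sum wf del: Comp_Plus_Arr TensorA_Plus_Arr)
  also have "(bangA ?f \<otimes> ?f) \<cdot> d A = d ?B \<cdot> bangA ?f"
    using A d_natural [of ?f ?B A] by (simp add: Hom_iff)
  also have "bangA ?f = \<Delta> ?B \<cdot> (?P \<otimes> ?Q) \<cdot> nabla A"
    using A by (intro bangA_Plus) (auto simp: Hom_iff)
  also have "(\<omega> A \<otimes> ?w) \<cdot> (d ?B \<cdot> (\<Delta> ?B \<cdot> (?P \<otimes> ?Q) \<cdot> nabla A))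
      = (\<omega> A \<otimes> ?w) \<cdot> ((d ?B \<cdot> \<Delta> ?B) \<cdot> (?P \<otimes> ?Q)) \<cdot> nabla A"
    using A by simp
  also have "(d ?B \<cdot> \<Delta> ?B) \<cdot> (?P \<otimes> ?Q) = ((\<Delta> ?B \<otimes> \<one> ?B) \<cdot> (?P \<otimes> (d ?B \<cdot> ?Q)))
      \<oplus> ((\<Delta> ?B \<otimes> \<one> ?B) \<cdot> ((\<one> (bangO ?B) \<otimes> \<sigma> (bangO ?B) ?B) \<cdot> ((d ?B \<cdot> ?P) \<otimes> ?Q)))"
    unfolding product_rule [OF B] using A by (simp add: interchange)
  also have "(\<omega> A \<otimes> ?w) \<cdot> \<dots> = ?I \<otimes> d A"
    using A by (subst Comp_Plus_Arr) (simp_all only: first second, simp_all)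
  finally show ?thesis .
qed

text \<open>One of the two inverse laws; it also converts the chain rule of \<open>d\<close> into
  that of \<open>\<eta>\<close>.\<close>

lemma \<eta>_nabla:
  assumes A: "A \<in> Obj C"
  shows "(\<one> (bangO A) \<otimes> \<eta> A) \<cdot> nabla A = d A"
proof -
  have "(\<one> (bangO A) \<otimes> \<eta> A) \<cdot> nabla A
      = (\<one> (bangO A) \<otimes> (u A \<otimes> \<one> A)) \<cdot> ((\<one> (bangO A) \<otimes> d A) \<cdot> nabla A)"
    using A by (simp add: \<eta>_def interchange_assoc)
  also have "\<dots> = ((\<one> (bangO A) \<otimes> u A) \<otimes> \<one> A) \<cdot> ((nabla A \<otimes> \<one> A) \<cdot> d A)"
    using A by (simp add: nabla_rule)
  also have "\<dots> = d A"
    using A by (simp add: interchange_assoc nabla_unit_right del: TensorA_assoc)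
  finally show ?thesis .
qed

sublocale codereliction C bangO bangA \<delta> \<epsilon> \<Delta> e nabla u \<eta>
proof
  show "\<eta> A \<in> Hom C A (bangO A)" if "A \<in> Obj C" for A
    using that by (simp add: Hom_iff)
  show "f \<cdot> \<eta> B = \<eta> A \<cdot> bangA f" if f: "f \<in> Hom C A B" for f A B
  proof -
    have AB: "A \<in> Obj C" "B \<in> Obj C"
      using f by (auto simp: Hom_iff)
    have "\<eta> A \<cdot> bangA f = (u A \<otimes> \<one> A) \<cdot> ((bangA f \<otimes> f) \<cdot> d B)"
      using f AB d_natural [OF f] by (simp add: \<eta>_def Hom_iff)
    also have "\<dots> = (u B \<otimes> f) \<cdot> d B"
      using f AB u_natural [OF f] by (auto simp: interchange_assoc Hom_iff)
    \<comment> \<open>Reading \<open>f\<close> as \<open>\<one> \<K> \<otimes> f\<close> makes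
      interchange applicable.\<close>
    also have "\<dots> = f \<cdot> \<eta> B"
      using f AB interchange_assoc [of "\<one> \<K>" "u B" f "\<one> B" "d B"] by (simp add: \<eta>_def Hom_iff)
    finally show ?thesis by simp
  qed
  show "\<eta> A \<cdot> e A = \<zero> A \<K>" "\<eta> A \<cdot> \<epsilon> A = \<one> A" if "A \<in> Obj C" for A
    using that by (simp_all add: \<eta>_e_eq \<eta>_\<epsilon>_eq)
  show "\<eta> A \<cdot> \<Delta> A = \<eta> A \<otimes> u A \<oplus> u A \<otimes> \<eta> A" if A: "A \<in> Obj C" for A
  proof -
    let ?I = "\<one> (bangO A)"
    \<comment> \<open>Since \<open>u\<close> is a comonoid morphism, the product rule restricted
      along \<open>u\<close> has one summand for each copy of \<open>u\<close>; in the second the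
      symmetry becomes trivial because \<open>u\<close> starts at the unit object.\<close>
    have "\<eta> A \<cdot> \<Delta> A = ((u A \<cdot> \<Delta> A) \<otimes> \<one> A) \<cdot> (?I \<otimes> d A \<oplus> (?I \<otimes> \<sigma> (bangO A) A) \<cdot> (d A \<otimes> ?I))"
      using A product_rule [OF A] by (simp add: \<eta>_def interchange_assoc)
    also have "\<dots> = (u A \<otimes> (u A \<otimes> \<one> A)) \<cdot> (?I \<otimes> d A)
        \<oplus> (u A \<otimes> (u A \<otimes> \<one> A)) \<cdot> ((?I \<otimes> \<sigma> (bangO A) A) \<cdot> (d A \<otimes> ?I))"
      unfolding u_\<Delta> [OF A] using A by simp
    also have "(u A \<otimes> (u A \<otimes> \<one> A)) \<cdot> (?I \<otimes> d A) = u A \<otimes> \<eta> A"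
      using A by (simp add: interchange \<eta>_def)
    also have "(u A \<otimes> (u A \<otimes> \<one> A)) \<cdot> ((?I \<otimes> \<sigma> (bangO A) A) \<cdot> (d A \<otimes> ?I))
        = ((u A \<otimes> \<one> A) \<otimes> u A) \<cdot> (d A \<otimes> ?I)"
      using A by (simp add: interchange_assoc Sym_slide)
    also have "\<dots> = \<eta> A \<otimes> u A"
      using A by (simp add: interchange \<eta>_def del: TensorA_assoc)
    finally show ?thesis
      using A by (simp add: Plus_commute_Arr)
  qed
  show "(\<one> (bangO A) \<otimes> \<eta> A) \<cdot> nabla A \<cdot> \<delta> A =
      (\<Delta> A \<otimes> \<eta> A) \<cdot> (\<one> (bangO A) \<otimes> nabla A) \<cdot> (\<delta> A \<otimes> \<eta> (bangO A)) \<cdot> nabla (bangO A)"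
    if A: "A \<in> Obj C" for A
  proof -
    let ?I = "\<one> (bangO A)"
    \<comment> \<open>Both codereliction factors, at \<open>A\<close> and at \<open>bangO A\<close>,
      are absorbed into \<open>d\<close> by \<open>\<eta>_nabla\<close>, which leaves the chain rule
      of \<open>d\<close>.\<close>
    have "(\<Delta> A \<otimes> \<eta> A) \<cdot> (?I \<otimes> nabla A) = (\<Delta> A \<otimes> \<one> A) \<cdot> (?I \<otimes> d A)"
      using A by (simp add: \<Delta>_tensor_nabla \<eta>_nabla)
    then have "(\<Delta> A \<otimes> \<eta> A) \<cdot> (?I \<otimes> nabla A) \<cdot> (\<delta> A \<otimes> \<eta> (bangO A)) \<cdot> nabla (bangO A)
        = (\<Delta> A \<otimes> \<one> A) \<cdot> ((?I \<otimes> d A) \<cdot> ((\<delta> A \<otimes> \<eta> (bangO A)) \<cdot> nabla (bangO A)))"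
      using A by (simp del: TensorA_assoc)
    also have "\<dots> = (\<Delta> A \<otimes> \<one> A) \<cdot> ((\<delta> A \<otimes> d A) \<cdot> ((\<one> (bangO (bangO A)) \<otimes> \<eta> (bangO A)) \<cdot> nabla (bangO A)))"
      using A by (simp add: interchange_assoc)
    also have "\<dots> = d A \<cdot> \<delta> A"
      using A chain_rule [OF A] by (simp add: \<eta>_nabla)
    also have "\<dots> = (?I \<otimes> \<eta> A) \<cdot> nabla A \<cdot> \<delta> A"
      using A by (simp add: \<eta>_nabla)
    finally show ?thesis ..
  qed
qed

lemma deriving_transformation_of_\<eta>:
  "A \<in> Obj C \<Longrightarrow> deriving_transformation_of C bangO nabla \<eta> A = d A"
  by (simp add: deriving_transformation_of_def \<eta>_nabla)

end

section \<open>From coderelictions to deriving transformations\<close>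

context codereliction
begin

abbreviation d where "d \<equiv> deriving_transformation_of C bangO nabla \<eta>"

lemma \<eta>_type [simp]:
  assumes "A \<in> Obj C"
  shows "\<eta> A \<in> Arr C" "Dom C (\<eta> A) = A" "Cod C (\<eta> A) = bangO A"
  using \<eta>_Hom [OF assms] by (auto simp: Hom_iff)

lemma d_def: "A \<in> Obj C \<Longrightarrow> d A = (\<one> (bangO A) \<otimes> \<eta> A) \<cdot> nabla A"
  by (simp add: deriving_transformation_of_def)

lemma d_type [simp]:
  assumes "A \<in> Obj C"
  shows "d A \<in> Arr C" "Dom C (d A) = bangO A \<odot> A" "Cod C (d A) = bangO A"
  using assms by (auto simp: d_def)

text \<open>The arrows \<open>u\<close> and \<open>\<eta>\<close> act on different factors, so
  \<open>u\<close> can be moved next to \<open>nabla\<close> and cancelled by the unit law.\<close>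

lemma u_d:
  assumes A: "A \<in> Obj C"
  shows "(u A \<otimes> \<one> A) \<cdot> d A = \<eta> A"
proof -
  have "(u A \<otimes> \<one> A) \<cdot> d A = (\<one> \<K> \<otimes> \<eta> A) \<cdot> ((u A \<otimes> \<one> (bangO A)) \<cdot> nabla A)"
    using A by (simp add: d_def interchange_assoc del: Unit_TensorA)
  then show ?thesis
    using A by (simp add: nabla_unit_left)
qed

lemma codereliction_of_d: "A \<in> Obj C \<Longrightarrow> codereliction_of C u d A = \<eta> A"
  by (simp add: codereliction_of_def u_d)

text \<open>The bialgebra law reduces the claim to \<open>\<eta>_\<Delta>\<close>. In each summand
  the factor \<open>u\<close> is absorbed by one \<open>nabla\<close>, and the other
  \<open>nabla\<close> with \<open>\<eta>\<close> forms \<open>d\<close>: the facts \<open>l\<close>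
  and \<open>r\<close> give the derivative of the first and of the second copy.\<close>

lemma d_\<Delta>:
  assumes A: "A \<in> Obj C"
  shows "d A \<cdot> \<Delta> A = (\<Delta> A \<otimes> \<one> A) \<cdot>
    (\<one> (bangO A) \<otimes> d A \<oplus> (\<one> (bangO A) \<otimes> \<sigma> (bangO A) A) \<cdot> (d A \<otimes> \<one> (bangO A)))"
proof -
  let ?I = "\<one> (bangO A)"
  let ?s = "?I \<otimes> (\<sigma> (bangO A) (bangO A) \<otimes> ?I)"
  have l: "(?I \<otimes> (?I \<otimes> (\<eta> A \<otimes> u A))) \<cdot> (?s \<cdot> (nabla A \<otimes> nabla A))
      = (?I \<otimes> \<sigma> (bangO A) A) \<cdot> (d A \<otimes> ?I)"
  proof -
    have "(?I \<otimes> (?I \<otimes> (\<eta> A \<otimes> u A))) \<cdot> (?s \<cdot> (nabla A \<otimes> nabla A))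
        = ((?I \<otimes> (?I \<otimes> (\<eta> A \<otimes> u A))) \<cdot> ?s) \<cdot> (nabla A \<otimes> nabla A)"
      using A by simp
    also have "\<dots> = (?I \<otimes> \<sigma> (bangO A) A) \<cdot> (((?I \<otimes> \<eta> A) \<otimes> (?I \<otimes> u A)) \<cdot> (nabla A \<otimes> nabla A))"
      using A by (subst middle_swap) simp_all
    also have "((?I \<otimes> \<eta> A) \<otimes> (?I \<otimes> u A)) \<cdot> (nabla A \<otimes> nabla A) = d A \<otimes> ?I"
      using A by (subst interchange) (simp_all add: d_def nabla_unit_right)
    finally show ?thesis .
  qed
  have r: "(?I \<otimes> (?I \<otimes> (u A \<otimes> \<eta> A))) \<cdot> (?s \<cdot> (nabla A \<otimes> nabla A)) = ?I \<otimes> d A"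
  proof -
    have "(?I \<otimes> (?I \<otimes> (u A \<otimes> \<eta> A))) \<cdot> (?s \<cdot> (nabla A \<otimes> nabla A))
        = ((?I \<otimes> (?I \<otimes> (u A \<otimes> \<eta> A))) \<cdot> ?s) \<cdot> (nabla A \<otimes> nabla A)"
      using A by simp
    also have "\<dots> = ((?I \<otimes> u A) \<otimes> (?I \<otimes> \<eta> A)) \<cdot> (nabla A \<otimes> nabla A)"
      using A by (subst middle_swap) simp_all
    also have "\<dots> = ?I \<otimes> d A"
      using A by (subst interchange) (simp_all add: d_def nabla_unit_right)
    finally show ?thesis .
  qed
  \<comment> \<open>Splits off the prefix \<open>\<Delta> A \<otimes> \<one> A\<close> that the two
    summands share.\<close>
  have *: "(\<Delta> A \<otimes> \<one> A) \<cdot> (?I \<otimes> (?I \<otimes> h)) = \<Delta> A \<otimes> h" if "h \<in> Arr C" "Dom C h = A" for h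
    using A that TensorA_assoc [of ?I ?I h, symmetric]
    by (simp add: interchange del: TensorA_assoc)
  have "d A \<cdot> \<Delta> A = (?I \<otimes> \<eta> A) \<cdot> (nabla A \<cdot> \<Delta> A)"
    using A by (simp add: d_def)
  also have "\<dots> = (\<Delta> A \<otimes> (\<eta> A \<cdot> \<Delta> A)) \<cdot> (?s \<cdot> (nabla A \<otimes> nabla A))"
    unfolding nabla_\<Delta> [OF A] using A by (simp add: interchange_assoc)
  also have "\<Delta> A \<otimes> (\<eta> A \<cdot> \<Delta> A)
      = (\<Delta> A \<otimes> \<one> A) \<cdot> ((?I \<otimes> (?I \<otimes> (\<eta> A \<otimes> u A))) \<oplus> (?I \<otimes> (?I \<otimes> (u A \<otimes> \<eta> A))))"
    unfolding \<eta>_\<Delta> [OF A] using A by (simp add: *)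
  also have "\<dots> \<cdot> (?s \<cdot> (nabla A \<otimes> nabla A)) = (\<Delta> A \<otimes> \<one> A) \<cdot>
      ((?I \<otimes> (?I \<otimes> (\<eta> A \<otimes> u A))) \<cdot> (?s \<cdot> (nabla A \<otimes> nabla A))
       \<oplus> (?I \<otimes> (?I \<otimes> (u A \<otimes> \<eta> A))) \<cdot> (?s \<cdot> (nabla A \<otimes> nabla A)))"
    using A by simp
  also have "\<dots> = (\<Delta> A \<otimes> \<one> A) \<cdot> (?I \<otimes> d A \<oplus> (?I \<otimes> \<sigma> (bangO A) A) \<cdot> (d A \<otimes> ?I))"
    unfolding l r using A by (subst Plus_commute_Arr) simp_all
  finally show ?thesis .
qed

sublocale deriving_transformation C bangO bangA \<delta> \<epsilon> \<Delta> e d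
proof
  show "d A \<in> Hom C (bangO A \<odot> A) (bangO A)" if "A \<in> Obj C" for A
    using that by (simp add: Hom_iff)
  show "(bangA f \<otimes> f) \<cdot> d B = d A \<cdot> bangA f" if f: "f \<in> Hom C A B" for f A B
  proof -
    have AB: "A \<in> Obj C" "B \<in> Obj C"
      using f by (auto simp: Hom_iff)
    have "d A \<cdot> bangA f = (\<one> (bangO A) \<otimes> \<eta> A) \<cdot> ((bangA f \<otimes> bangA f) \<cdot> nabla B)"
      using f AB nabla_natural [OF f] by (simp add: d_def Hom_iff)
    also have "\<dots> = (bangA f \<otimes> (f \<cdot> \<eta> B)) \<cdot> nabla B"
      using f AB \<eta>_natural [OF f] by (auto simp: interchange_assoc Hom_iff)
    also have "\<dots> = (bangA f \<otimes> f) \<cdot> d B"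
      using f AB by (auto simp: d_def interchange_assoc Hom_iff)
    finally show ?thesis by simp
  qed
  show "d A \<cdot> e A = \<zero> (bangO A \<odot> A) \<K>" if A: "A \<in> Obj C" for A
    using A nabla_e [OF A] \<eta>_e [OF A] by (simp add: d_def interchange)
  show "d A \<cdot> \<Delta> A = (\<Delta> A \<otimes> \<one> A) \<cdot>
      (\<one> (bangO A) \<otimes> d A \<oplus> (\<one> (bangO A) \<otimes> \<sigma> (bangO A) A) \<cdot> (d A \<otimes> \<one> (bangO A)))"
    if "A \<in> Obj C" for A
    using that by (rule d_\<Delta>)
  show "d A \<cdot> \<epsilon> A = e A \<otimes> \<one> A" if A: "A \<in> Obj C" for A
    using A nabla_\<epsilon> [OF A] \<eta>_e [OF A] \<eta>_\<epsilon> [OF A] by (simp add: d_def interchange)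
  show "d A \<cdot> \<delta> A = (\<Delta> A \<otimes> \<one> A) \<cdot> (\<delta> A \<otimes> d A) \<cdot> d (bangO A)" if A: "A \<in> Obj C" for A
  proof -
    let ?I = "\<one> (bangO A)"
    have "d A \<cdot> \<delta> A
        = ((\<Delta> A \<otimes> \<eta> A) \<cdot> (?I \<otimes> nabla A)) \<cdot> ((\<delta> A \<otimes> \<eta> (bangO A)) \<cdot> nabla (bangO A))"
      using A \<eta>_chain_rule [OF A] by (simp add: d_def)
    also have "(\<Delta> A \<otimes> \<eta> A) \<cdot> (?I \<otimes> nabla A) = (\<Delta> A \<otimes> \<one> A) \<cdot> (?I \<otimes> d A)"
      using A by (simp add: \<Delta>_tensor_nabla d_def)
    also have "\<dots> \<cdot> ((\<delta> A \<otimes> \<eta> (bangO A)) \<cdot> nabla (bangO A))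
        = (\<Delta> A \<otimes> \<one> A) \<cdot> (\<delta> A \<otimes> d A) \<cdot> d (bangO A)"
      using A by (simp add: d_def [of "bangO A"] interchange_assoc)
    finally show ?thesis .
  qed
  \<comment> \<open>By associativity, differentiating twice is multiplication by
    \<open>(\<eta> A \<otimes> \<eta> A) \<cdot> nabla A\<close>, which is symmetric in the two
    directions because \<open>nabla\<close> is commutative and the symmetry natural.\<close>
  show "(d A \<otimes> \<one> A) \<cdot> d A = (\<one> (bangO A) \<otimes> \<sigma> A A) \<cdot> (d A \<otimes> \<one> A) \<cdot> d A"
    if A: "A \<in> Obj C" for A
  proof -
    let ?I = "\<one> (bangO A)"
    have "(d A \<otimes> \<one> A) \<cdot> d A = (((?I \<otimes> \<eta> A) \<otimes> \<eta> A) \<cdot> (nabla A \<otimes> ?I)) \<cdot> nabla A"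
      using A by (simp add: d_def interchange_assoc interchange del: TensorA_assoc)
    also have "\<dots> = (?I \<otimes> (\<eta> A \<otimes> \<eta> A)) \<cdot> ((?I \<otimes> nabla A) \<cdot> nabla A)"
      using A nabla_assoc [OF A] by simp
    also have "\<dots> = (?I \<otimes> ((\<eta> A \<otimes> \<eta> A) \<cdot> nabla A)) \<cdot> nabla A"
      using A by (simp add: interchange_assoc)
    finally have dd: "(d A \<otimes> \<one> A) \<cdot> d A = (?I \<otimes> ((\<eta> A \<otimes> \<eta> A) \<cdot> nabla A)) \<cdot> nabla A" .
    have "\<sigma> A A \<cdot> ((\<eta> A \<otimes> \<eta> A) \<cdot> nabla A) = (\<sigma> A A \<cdot> (\<eta> A \<otimes> \<eta> A)) \<cdot> nabla A"
      using A by simp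
    also have "\<sigma> A A \<cdot> (\<eta> A \<otimes> \<eta> A) = (\<eta> A \<otimes> \<eta> A) \<cdot> \<sigma> (bangO A) (bangO A)"
      using A by (simp add: Sym_slide)
    also have "\<dots> \<cdot> nabla A = (\<eta> A \<otimes> \<eta> A) \<cdot> nabla A"
      using A nabla_commutative [OF A] by simp
    finally have "(?I \<otimes> \<sigma> A A) \<cdot> ((d A \<otimes> \<one> A) \<cdot> d A) = (d A \<otimes> \<one> A) \<cdot> d A"
      unfolding dd using A by (simp add: interchange_assoc)
    then show ?thesis
      using A by simp
  qed
qed

end

section \<open>The \<open>nabla\<close>-rule and the mutually inverse bijections\<close>

theorem theorem6p9:
  fixes C :: "('o, 'a, 'x) additive_smc_data_scheme"
    and bangO :: "'o \<Rightarrow> 'o" and bangA :: "'a \<Rightarrow> 'a"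
    and \<delta> \<epsilon> \<Delta> e nabla u :: "'o \<Rightarrow> 'a"
  assumes "additive_bialgebra_modality C bangO bangA \<delta> \<epsilon> \<Delta> e nabla u"
  shows "(\<forall>d. deriving_transformation C bangO bangA \<delta> \<epsilon> \<Delta> e d \<longrightarrow>
        (\<forall>A\<in>Obj C. (nabla A \<otimes>\<^bsub>C\<^esub> \<one>\<^bsub>C\<^esub> A) \<cdot>\<^bsub>C\<^esub> d A = (\<one>\<^bsub>C\<^esub> (bangO A) \<otimes>\<^bsub>C\<^esub> d A) \<cdot>\<^bsub>C\<^esub> nabla A))
    \<and> bij_betw (codereliction_of C u)
        (deriving_transformations C bangO bangA \<delta> \<epsilon> \<Delta> e)
        (coderelictions C bangO bangA \<delta> \<epsilon> \<Delta> e nabla u)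
    \<and> bij_betw (deriving_transformation_of C bangO nabla)
        (coderelictions C bangO bangA \<delta> \<epsilon> \<Delta> e nabla u)
        (deriving_transformations C bangO bangA \<delta> \<epsilon> \<Delta> e)
    \<and> (\<forall>d\<in>deriving_transformations C bangO bangA \<delta> \<epsilon> \<Delta> e.
        deriving_transformation_of C bangO nabla (codereliction_of C u d) = d)
    \<and> (\<forall>\<eta>\<in>coderelictions C bangO bangA \<delta> \<epsilon> \<Delta> e nabla u.
        codereliction_of C u (deriving_transformation_of C bangO nabla \<eta>) = \<eta>)"
proof -
  let ?DT = "deriving_transformations C bangO bangA \<delta> \<epsilon> \<Delta> e"
  let ?CD = "coderelictions C bangO bangA \<delta> \<epsilon> \<Delta> e nabla u"
  let ?F = "codereliction_of C u" and ?G = "deriving_transformation_of C bangO nabla"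
  have loc: "deriving_transformation_on_additive_bialgebra_modality C bangO bangA \<delta> \<epsilon> \<Delta> e nabla u d"
    if "deriving_transformation C bangO bangA \<delta> \<epsilon> \<Delta> e d" for d
    using assms that by (simp add: deriving_transformation_on_additive_bialgebra_modality_def)
  have F: "?F d \<in> ?CD" and GF: "?G (?F d) = d" if "d \<in> ?DT" for d
  proof -
    interpret deriving_transformation_on_additive_bialgebra_modality
      C bangO bangA \<delta> \<epsilon> \<Delta> e nabla u d
      using that by (intro loc) (simp add: deriving_transformations_def)
    show "?F d \<in> ?CD"
      using codereliction_axioms by (simp add: coderelictions_def codereliction_of_def)
    show "?G (?F d) = d"
    \<comment> \<open>Both families are \<open>undefined\<close> outside \<open>Obj C\<close>, so
      agreement of their components at objects suffices.\<close>
    proof (rule extensionalityI)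
      show "?G (?F d) \<in> extensional (Obj C)" "d \<in> extensional (Obj C)"
        using that by (simp_all add: deriving_transformation_of_def deriving_transformations_def)
    qed (rule deriving_transformation_of_\<eta>)
  qed
  have G: "?G \<eta> \<in> ?DT" and FG: "?F (?G \<eta>) = \<eta>" if "\<eta> \<in> ?CD" for \<eta>
  proof -
    interpret codereliction C bangO bangA \<delta> \<epsilon> \<Delta> e nabla u \<eta>
      using that by (simp add: coderelictions_def)
    show "?G \<eta> \<in> ?DT"
      using deriving_transformation_axioms
      by (simp add: deriving_transformations_def deriving_transformation_of_def)
    show "?F (?G \<eta>) = \<eta>"
    proof (rule extensionalityI)
      show "?F (?G \<eta>) \<in> extensional (Obj C)" "\<eta> \<in> extensional (Obj C)"
        using that by (simp_all add: codereliction_of_def coderelictions_def)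
    qed (rule codereliction_of_d)
  qed
  have "bij_betw ?F ?DT ?CD" "bij_betw ?G ?CD ?DT"
    by (rule bij_betw_byWitness [where f' = ?G]; use F G FG GF in blast)
      (rule bij_betw_byWitness [where f' = ?F]; use F G FG GF in blast)
  moreover have "\<forall>d. deriving_transformation C bangO bangA \<delta> \<epsilon> \<Delta> e d \<longrightarrow>
      (\<forall>A\<in>Obj C. (nabla A \<otimes>\<^bsub>C\<^esub> \<one>\<^bsub>C\<^esub> A) \<cdot>\<^bsub>C\<^esub> d A = (\<one>\<^bsub>C\<^esub> (bangO A) \<otimes>\<^bsub>C\<^esub> d A) \<cdot>\<^bsub>C\<^esub> nabla A)"
    using deriving_transformation_on_additive_bialgebra_modality.nabla_rule [OF loc] by blast
  ultimately show ?thesis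
    using FG GF by blast
qed

end
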